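(* Let $Y\in\mathbb{V}(X)$, let $\phi(x,y_1,\dots,y_n)$ be a totally open formula, let $S_1,\dots,S_n\in\mathbb{V}(X)$ and $Q_1,\dots,Q_n\in\{\exists,\forall\}$. Assume $\exists x\,Q_1y_1\in S_1\dots Q_ny_n\in S_n\,\phi(x,y_1,\dots,y_n)$ is partition regular on $Y$ and that the ultrafilter $\mathcal{U}$ on $Y$ witnesses it. Then: (a) for every $A\in\mathcal{U}$, the set $I_A(\phi)=\{a\in A\mid Q_1y_1\in S_1\dots Q_ny_n\in S_n\,\phi(a,y_1,\dots,y_n)\text{ holds}\}$ belongs to $\mathcal{U}$; (b) if moreover $\psi(x,z_1,\dots,z_m)$ is a totally open formula, $R_1,\dots,R_m\in\mathbb{V}(X)$, $\widetilde{Q}_1,\dots,\widetilde{Q}_m\in\{\exists,\forall\}$, and $\mathcal{U}$ also witnesses $\exists x\,\widetilde{Q}_1z_1\in R_1\dots\widetilde{Q}_mz_m\in R_m\,\psi(x,z_1,\dots,z_m)$, then $\mathcal{U}$ witnesses \[\exists x\,Q_1y_1\in S_1\dots Q_ny_n\in S_n\,\widetilde{Q}_1z_1\in R_1\dots\widetilde{Q}_mz_m\in R_m\ \phi(x,y_1,\dots,y_n)\wedge\psi(x,z_1,\dots,z_m),\] which is therefore partition regular on $Y$.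
   Context: Formulas are first-order formulas with bounded quantifiers in the language of the superstructure $\mathbb{V}(X)$; totally open means all variables are free. A set $A\subseteq Y$ models $\exists x\,Q_1y_1\in S_1\dots Q_ny_n\in S_n\,\phi$ if there is $x\in A$ with $Q_1y_1\in S_1\dots Q_ny_n\in S_n\,\phi(x,y_1,\dots,y_n)$ true. Such a formula is partition regular on $Y$ if for every finite partition $Y=A_1\cup\dots\cup A_k$ some $A_i$ models it; an ultrafilter $\mathcal{U}$ on $Y$ witnesses it if every $A\in\mathcal{U}$ models it. *)

theory Defs
  imports Main "HOL-Library.Disjoint_Sets" "HOL-Library.Nat_Bijection"
begin

section \<open>Superstructures\<close>

text \<open>
  HOL has no single type containing all iterated powersets of an infinite set, so the superstructure
  is built inside an arbitrary type \<open>'v\<close>: the function \<open>mk\<close> returns the object of \<open>'v\<close> that plays the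
  role of the set \<open>B :: 'v set\<close>. The predicate \<open>superstructure\<close> says that distinct sets
  arising in the construction are distinct objects and that no such set is an element of the base
  set \<open>X\<close>; this determines the superstructure over \<open>X\<close> up to isomorphism.
\<close>

primrec level :: "('v set \<Rightarrow> 'v) \<Rightarrow> 'v set \<Rightarrow> nat \<Rightarrow> 'v set" where
  "level mk X 0 = X"
| "level mk X (Suc n) = level mk X n \<union> mk ` Pow (level mk X n)"

definition V :: "('v set \<Rightarrow> 'v) \<Rightarrow> 'v set \<Rightarrow> 'v set" where
  "V mk X = (\<Union>n. level mk X n)"

definition superstructure :: "('v set \<Rightarrow> 'v) \<Rightarrow> 'v set \<Rightarrow> bool" where
  "superstructure mk X \<longleftrightarrow>
     inj_on mk (\<Union>n. Pow (level mk X n)) \<and> mk ` (\<Union>n. Pow (level mk X n)) \<inter> X = {}"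

definition elts :: "('v set \<Rightarrow> 'v) \<Rightarrow> 'v set \<Rightarrow> 'v \<Rightarrow> 'v set" where
  "elts mk X b = {a. \<exists>n B. B \<subseteq> level mk X n \<and> b = mk B \<and> a \<in> B}"

lemma elts_mk:
  assumes "superstructure mk X" "B \<subseteq> level mk X n"
  shows "elts mk X (mk B) = B"
proof -
  have "C = B" if "C \<subseteq> level mk X k" "mk B = mk C" for C k
    using assms that unfolding superstructure_def inj_on_def by blast
  then show ?thesis
    using assms(2) unfolding elts_def by blast
qed

lemma elts_atom: "superstructure mk X \<Longrightarrow> a \<in> X \<Longrightarrow> elts mk X a = {}"
  unfolding superstructure_def elts_def by blast

lemma level_mono: "m \<le> n \<Longrightarrow> level mk X m \<subseteq> level mk X n"
  by (induction n) (auto simp: le_Suc_eq)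

lemma V_transitive:
  assumes "a \<in> elts mk X b"
  shows "a \<in> V mk X"
  using assms unfolding elts_def V_def by blast

lemma mk_in_V: "B \<subseteq> level mk X n \<Longrightarrow> mk B \<in> V mk X"
  unfolding V_def by (rule UN_I[of "Suc n"]) auto

text \<open>
  Any type with enough room carries a superstructure over \<open>X\<close>: it suffices that the iterated powersets
  can be placed injectively into pairwise disjoint sets \<open>W 0, W 1, \<dots>\<close> that avoid \<open>X\<close>.
\<close>

lemma superstructure_exists:
  fixes X :: "'v set" and W :: "nat \<Rightarrow> 'v set" and f :: "nat \<Rightarrow> 'v set \<Rightarrow> 'v"
  defines "L \<equiv> \<lambda>n. X \<union> (\<Union>k<n. W k)"
  assumes disj: "\<And>m n. m \<noteq> n \<Longrightarrow> W m \<inter> W n = {}" and X: "\<And>n. W n \<inter> X = {}"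
    and inj: "\<And>n. inj_on (f n) (Pow (L n))" and im: "\<And>n. f n ` Pow (L n) \<subseteq> W n"
  shows "\<exists>mk. superstructure mk X"
proof -
  define r where "r = (\<lambda>B. LEAST n. B \<subseteq> L n)"
  define mk where "mk = (\<lambda>B. f (r B) B)"
  have r: "B \<subseteq> L (r B)" "r B \<le> n" if "B \<subseteq> L n" for B n
    using that unfolding r_def by (rule LeastI, rule Least_le)
  have mk: "mk B \<in> W (r B)" if "B \<subseteq> L n" for B n
    using im r(1)[OF that] unfolding mk_def by blast
  have lev: "level mk X n \<subseteq> L n" for n
  proof (induction n)
    case 0
    show ?case by (simp add: L_def)
  next
    case (Suc n)
    have "mk B \<in> L (Suc n)" if "B \<subseteq> level mk X n" for B
    proof -
      have B: "B \<subseteq> L n" using that Suc by blast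
      show ?thesis
        using mk[OF B] r(2)[OF B] unfolding L_def by (auto simp: less_Suc_eq_le)
    qed
    moreover have "L n \<subseteq> L (Suc n)"
      unfolding L_def by (auto simp: less_Suc_eq)
    ultimately show ?case
      using Suc by auto
  qed
  have "inj_on mk (\<Union>n. Pow (level mk X n))"
  proof (rule inj_onI)
    fix B C
    assume "B \<in> (\<Union>n. Pow (level mk X n))" "C \<in> (\<Union>n. Pow (level mk X n))" and eq: "mk B = mk C"
    then obtain m n where B: "B \<subseteq> L m" and C: "C \<subseteq> L n"
      using lev by blast
    have "r B = r C"
      using mk[OF B] mk[OF C] eq disj[of "r B" "r C"] by auto
    then show "B = C"
      using inj[of "r B"] r(1)[OF B] r(1)[OF C] eq unfolding mk_def inj_on_def by auto
  qed
  moreover have "mk B \<notin> X" if "B \<subseteq> level mk X n" for B n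
    using mk[of B n] X lev that by blast
  ultimately have "superstructure mk X"
    unfolding superstructure_def by blast
  then show ?thesis by blast
qed

lemma superstructure_nat:
  "superstructure (\<lambda>B. set_encode B + k) {..<k}"
proof -
  let ?mk = "\<lambda>B. set_encode B + k"
  have "finite (level ?mk {..<k} n)" for n
    by (induction n) auto
  then have "(\<Union>n. Pow (level ?mk {..<k} n)) \<subseteq> Collect finite"
    by (auto intro: finite_subset)
  then have "inj_on ?mk (\<Union>n. Pow (level ?mk {..<k} n))"
    using inj_on_subset[OF inj_on_set_encode] by (simp add: inj_on_def)
  then show ?thesis
    unfolding superstructure_def by auto
qed


section \<open>Formulas with bounded quantifiers\<close>

text \<open>
  The symbols are membership, equality, a constant for each object of the superstructure, and
  ordered pairing, which iterates to tuples.
\<close>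

datatype 'v trm = Var nat | Const 'v | Pr "'v trm" "'v trm"

datatype 'v form =
    Mem "'v trm" "'v trm"
  | Eql "'v trm" "'v trm"
  | Neg "'v form"
  | Conj "'v form" "'v form"
  | Disj "'v form" "'v form"
  | Imp "'v form" "'v form"
  | Iff "'v form" "'v form"
  | All nat "'v trm" "'v form"
  | Exi nat "'v trm" "'v form"

primrec tvars :: "'v trm \<Rightarrow> nat set" where
  "tvars (Var i) = {i}"
| "tvars (Const c) = {}"
| "tvars (Pr s t) = tvars s \<union> tvars t"

primrec free_vars :: "'v form \<Rightarrow> nat set" where
  "free_vars (Mem s t) = tvars s \<union> tvars t"
| "free_vars (Eql s t) = tvars s \<union> tvars t"
| "free_vars (Neg \<phi>) = free_vars \<phi>"
| "free_vars (Conj \<phi> \<psi>) = free_vars \<phi> \<union> free_vars \<psi>"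
| "free_vars (Disj \<phi> \<psi>) = free_vars \<phi> \<union> free_vars \<psi>"
| "free_vars (Imp \<phi> \<psi>) = free_vars \<phi> \<union> free_vars \<psi>"
| "free_vars (Iff \<phi> \<psi>) = free_vars \<phi> \<union> free_vars \<psi>"
| "free_vars (All i t \<phi>) = tvars t \<union> (free_vars \<phi> - {i})"
| "free_vars (Exi i t \<phi>) = tvars t \<union> (free_vars \<phi> - {i})"

primrec bound_vars :: "'v form \<Rightarrow> nat set" where
  "bound_vars (Mem s t) = {}"
| "bound_vars (Eql s t) = {}"
| "bound_vars (Neg \<phi>) = bound_vars \<phi>"
| "bound_vars (Conj \<phi> \<psi>) = bound_vars \<phi> \<union> bound_vars \<psi>"
| "bound_vars (Disj \<phi> \<psi>) = bound_vars \<phi> \<union> bound_vars \<psi>"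
| "bound_vars (Imp \<phi> \<psi>) = bound_vars \<phi> \<union> bound_vars \<psi>"
| "bound_vars (Iff \<phi> \<psi>) = bound_vars \<phi> \<union> bound_vars \<psi>"
| "bound_vars (All i t \<phi>) = insert i (bound_vars \<phi>)"
| "bound_vars (Exi i t \<phi>) = insert i (bound_vars \<phi>)"

definition totally_open :: "'v form \<Rightarrow> bool" where
  "totally_open \<phi> \<longleftrightarrow> bound_vars \<phi> = {}"

text \<open>\<open>set_form \<phi>\<close> is the set of constants occurring in \<open>\<phi>\<close>.\<close>

definition formula_over :: "('v set \<Rightarrow> 'v) \<Rightarrow> 'v set \<Rightarrow> 'v form \<Rightarrow> bool" where
  "formula_over mk X \<phi> \<longleftrightarrow> set_form \<phi> \<subseteq> V mk X"

primrec tval :: "('v set \<Rightarrow> 'v) \<Rightarrow> (nat \<Rightarrow> 'v) \<Rightarrow> 'v trm \<Rightarrow> 'v" where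
  "tval mk v (Var i) = v i"
| "tval mk v (Const c) = c"
| "tval mk v (Pr s t) = mk {mk {tval mk v s}, mk {tval mk v s, tval mk v t}}"

primrec sat :: "('v set \<Rightarrow> 'v) \<Rightarrow> 'v set \<Rightarrow> (nat \<Rightarrow> 'v) \<Rightarrow> 'v form \<Rightarrow> bool" where
  "sat mk X v (Mem s t) \<longleftrightarrow> tval mk v s \<in> elts mk X (tval mk v t)"
| "sat mk X v (Eql s t) \<longleftrightarrow> tval mk v s = tval mk v t"
| "sat mk X v (Neg \<phi>) \<longleftrightarrow> \<not> sat mk X v \<phi>"
| "sat mk X v (Conj \<phi> \<psi>) \<longleftrightarrow> sat mk X v \<phi> \<and> sat mk X v \<psi>"
| "sat mk X v (Disj \<phi> \<psi>) \<longleftrightarrow> sat mk X v \<phi> \<or> sat mk X v \<psi>"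
| "sat mk X v (Imp \<phi> \<psi>) \<longleftrightarrow> (sat mk X v \<phi> \<longrightarrow> sat mk X v \<psi>)"
| "sat mk X v (Iff \<phi> \<psi>) \<longleftrightarrow> (sat mk X v \<phi> \<longleftrightarrow> sat mk X v \<psi>)"
| "sat mk X v (All i t \<phi>) \<longleftrightarrow> (\<forall>a \<in> elts mk X (tval mk v t). sat mk X (v(i := a)) \<phi>)"
| "sat mk X v (Exi i t \<phi>) \<longleftrightarrow> (\<exists>a \<in> elts mk X (tval mk v t). sat mk X (v(i := a)) \<phi>)"

datatype quant = QEx | QAll

datatype 'v bquant = BQ (kind: quant) (bvar: nat) (bdom: 'v)

text \<open>
  \<open>close [BQ Q\<^sub>1 y\<^sub>1 S\<^sub>1, \<dots>, BQ Q\<^sub>n y\<^sub>n S\<^sub>n] \<phi>\<close> is the formula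
  \<open>Q\<^sub>1y\<^sub>1 \<in> S\<^sub>1 \<dots> Q\<^sub>ny\<^sub>n \<in> S\<^sub>n \<phi>\<close>.
\<close>

primrec close :: "'v bquant list \<Rightarrow> 'v form \<Rightarrow> 'v form" where
  "close [] \<phi> = \<phi>"
| "close (q # qs) \<phi> =
     (case kind q of
        QEx \<Rightarrow> Exi (bvar q) (Const (bdom q)) (close qs \<phi>)
      | QAll \<Rightarrow> All (bvar q) (Const (bdom q)) (close qs \<phi>))"

text \<open>
  \<open>holds_at mk X x \<Phi> a\<close> evaluates \<open>\<Phi>(a)\<close> for a formula \<open>\<Phi>\<close> whose only free variable is \<open>x\<close>;
  the value of the assignment elsewhere is then irrelevant.
\<close>

definition holds_at :: "('v set \<Rightarrow> 'v) \<Rightarrow> 'v set \<Rightarrow> nat \<Rightarrow> 'v form \<Rightarrow> 'v \<Rightarrow> bool" where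
  "holds_at mk X x \<Phi> a \<longleftrightarrow> sat mk X ((\<lambda>_. undefined)(x := a)) \<Phi>"


section \<open>Partition regularity and ultrafilters\<close>

text \<open>In the following, \<open>x\<close> and \<open>\<Phi>\<close> together stand for the sentence \<open>\<exists>x \<Phi>(x)\<close>.\<close>

definition models :: "('v set \<Rightarrow> 'v) \<Rightarrow> 'v set \<Rightarrow> 'v set \<Rightarrow> nat \<Rightarrow> 'v form \<Rightarrow> bool" where
  "models mk X A x \<Phi> \<longleftrightarrow> (\<exists>a\<in>A. holds_at mk X x \<Phi> a)"

definition partition_regular ::
  "('v set \<Rightarrow> 'v) \<Rightarrow> 'v set \<Rightarrow> 'v \<Rightarrow> nat \<Rightarrow> 'v form \<Rightarrow> bool" where
  "partition_regular mk X Y x \<Phi> \<longleftrightarrow>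
     (\<forall>\<A>. finite \<A> \<and> partition_on (elts mk X Y) \<A> \<longrightarrow> (\<exists>A\<in>\<A>. models mk X A x \<Phi>))"

definition witnesses ::
  "('v set \<Rightarrow> 'v) \<Rightarrow> 'v set \<Rightarrow> 'v set set \<Rightarrow> nat \<Rightarrow> 'v form \<Rightarrow> bool" where
  "witnesses mk X \<U> x \<Phi> \<longleftrightarrow> (\<forall>A\<in>\<U>. models mk X A x \<Phi>)"

definition ultrafilter_on :: "'a set \<Rightarrow> 'a set set \<Rightarrow> bool" where
  "ultrafilter_on S \<U> \<longleftrightarrow>
     \<U> \<subseteq> Pow S \<and> S \<in> \<U> \<and> {} \<notin> \<U> \<and>
     (\<forall>A\<in>\<U>. \<forall>B\<in>\<U>. A \<inter> B \<in> \<U>) \<and>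
     (\<forall>A\<in>\<U>. \<forall>B. A \<subseteq> B \<and> B \<subseteq> S \<longrightarrow> B \<in> \<U>) \<and>
     (\<forall>A. A \<subseteq> S \<longrightarrow> A \<in> \<U> \<or> S - A \<in> \<U>)"

end

theory Submission
  imports Defs
begin

text \<open>
  Let \<open>I\<close> be the set of points of \<open>Y\<close> that satisfy a property witnessed by \<open>\<U>\<close>. The complement
  of \<open>I\<close> contains no such point, so it is not in \<open>\<U>\<close>, and hence \<open>I\<close> is. Two witnessed
  properties therefore hold simultaneously on a set of \<open>\<U>\<close>, and a conjunction of two prenex formulas
  in disjoint bound variables implies its prenex form, even when some quantifier domains are empty.
\<close>

lemma tval_cong:
  assumes "\<And>i. i \<in> tvars t \<Longrightarrow> v i = w i"
  shows "tval mk v t = tval mk w t"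
  using assms by (induction t) simp_all

text \<open>The coincidence lemma. It is needed so that giving a value to a variable foreign to a
  formula leaves the truth of that formula unchanged.\<close>

lemma sat_cong:
  assumes "\<And>i. i \<in> free_vars \<Phi> \<Longrightarrow> v i = w i"
  shows "sat mk X v \<Phi> \<longleftrightarrow> sat mk X w \<Phi>"
  using assms
proof (induction \<Phi> arbitrary: v w)
  case (Mem s t)
  then show ?case using tval_cong[of s v w mk] tval_cong[of t v w mk] by simp
next
  case (Eql s t)
  then show ?case using tval_cong[of s v w mk] tval_cong[of t v w mk] by simp
next
  case (Neg \<Phi>)
  show ?case by (simp add: Neg.IH[of v w] Neg.prems)
next
  case (Conj \<Phi> \<Psi>)
  show ?case by (simp add: Conj.IH[of v w] Conj.prems)
next
  case (Disj \<Phi> \<Psi>)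
  show ?case by (simp add: Disj.IH[of v w] Disj.prems)
next
  case (Imp \<Phi> \<Psi>)
  show ?case by (simp add: Imp.IH[of v w] Imp.prems)
next
  case (Iff \<Phi> \<Psi>)
  show ?case by (simp add: Iff.IH[of v w] Iff.prems)
next
  case (All i t \<Phi>)
  \<comment> \<open>Both assignments receive the value \<open>a\<close> at \<open>i\<close>, so
    agreement off \<open>i\<close> suffices here; the bound \<open>t\<close> is evaluated before the
    update.\<close>
  have "sat mk X (v(i := a)) \<Phi> \<longleftrightarrow> sat mk X (w(i := a)) \<Phi>" for a
    using All.prems by (intro All.IH) simp
  moreover have "tval mk v t = tval mk w t"
    using All.prems by (intro tval_cong) simp
  ultimately show ?case by simp
next
  case (Exi i t \<Phi>)
  have "sat mk X (v(i := a)) \<Phi> \<longleftrightarrow> sat mk X (w(i := a)) \<Phi>" for a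
    using Exi.prems by (intro Exi.IH) simp
  moreover have "tval mk v t = tval mk w t"
    using Exi.prems by (intro tval_cong) simp
  ultimately show ?case by simp
qed

lemma sat_upd_fresh: "i \<notin> free_vars \<Phi> \<Longrightarrow> sat mk X (v(i := a)) \<Phi> \<longleftrightarrow> sat mk X v \<Phi>"
  by (rule sat_cong) auto

lemma free_vars_close: "free_vars (close qs \<Phi>) = free_vars \<Phi> - bvar ` set qs"
  by (induction qs) (auto split: quant.split)

lemma close_append: "close (qs @ rs) \<Phi> = close qs (close rs \<Phi>)"
  by (induction qs) (simp_all split: quant.split)

text \<open>The side formula \<open>\<Theta>\<close> does not mention the quantified variables, so
  it stays true whatever values they take and is still available under the whole prefix.\<close>

lemma sat_close_mono:
  assumes "sat mk X v (close qs \<Phi>)" and "sat mk X v \<Theta>"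
    and "bvar ` set qs \<inter> free_vars \<Theta> = {}"
    and "\<And>w. sat mk X w \<Phi> \<Longrightarrow> sat mk X w \<Theta> \<Longrightarrow> sat mk X w \<Psi>"
  shows "sat mk X v (close qs \<Psi>)"
  using assms(1-3)
proof (induction qs arbitrary: v)
  case Nil
  then show ?case using assms(4) by simp
next
  case (Cons q qs)
  \<comment> \<open>An implication for each single value serves both quantifiers, since each is
    monotone; no element of the domain has to be produced.\<close>
  have "sat mk X (v(bvar q := a)) (close qs \<Psi>)"
    if "sat mk X (v(bvar q := a)) (close qs \<Phi>)" for a
  proof (rule Cons.IH[OF that])
    show "sat mk X (v(bvar q := a)) \<Theta>"
      using Cons.prems(2,3) by (simp add: sat_upd_fresh)
    show "bvar ` set qs \<inter> free_vars \<Theta> = {}"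
      using Cons.prems(3) by auto
  qed
  then show ?case
    using Cons.prems(1) by (auto split: quant.splits)
qed

text \<open>Monotonicity is used twice: first \<open>close rs \<psi>\<close> is carried under the
  prefix \<open>qs\<close>, then \<open>\<phi>\<close> is carried under \<open>rs\<close>. Only this
  direction holds in general: a universal quantifier over an empty domain in \<open>qs\<close> makes
  the joint formula true whatever \<open>\<psi>\<close> says.\<close>

lemma sat_close_append_Conj:
  assumes "sat mk X v (close qs \<phi>)" and "sat mk X v (close rs \<psi>)"
    and "bvar ` set qs \<inter> free_vars (close rs \<psi>) = {}" and "bvar ` set rs \<inter> free_vars \<phi> = {}"
  shows "sat mk X v (close (qs @ rs) (Conj \<phi> \<psi>))"
  unfolding close_append
proof (rule sat_close_mono[OF assms(1,2,3)])
  fix w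
  assume "sat mk X w \<phi>" "sat mk X w (close rs \<psi>)"
  then show "sat mk X w (close rs (Conj \<phi> \<psi>))"
    using sat_close_mono[of mk X w rs \<psi> \<phi> "Conj \<phi> \<psi>"] assms(4) by simp
qed

text \<open>If \<open>A\<close> is not in the ultrafilter, its complement is, and this meets the
  union inside the union of the remaining sets, to which induction applies.\<close>

lemma ultrafilter_on_mem_finite_Union:
  assumes "ultrafilter_on S \<U>" and "finite \<A>" and "\<Union>\<A> \<in> \<U>"
  shows "\<exists>A\<in>\<A>. A \<in> \<U>"
  using assms(2,3)
proof (induction \<A> rule: finite_induct)
  case empty
  then show ?case using assms(1) by (simp add: ultrafilter_on_def)
next
  case (insert A \<A>)
  have sub: "A \<union> \<Union>\<A> \<subseteq> S"
    using assms(1) insert.prems unfolding ultrafilter_on_def by auto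
  show ?case
  proof (cases "A \<in> \<U>")
    case False
    then have "S - A \<in> \<U>"
      using assms(1) sub unfolding ultrafilter_on_def by blast
    then have "(\<Union>(insert A \<A>)) \<inter> (S - A) \<in> \<U>"
      using assms(1) insert.prems unfolding ultrafilter_on_def by blast
    moreover have "(\<Union>(insert A \<A>)) \<inter> (S - A) \<subseteq> \<Union>\<A>" and "\<Union>\<A> \<subseteq> S"
      using sub by auto
    ultimately have "\<Union>\<A> \<in> \<U>"
      using assms(1) unfolding ultrafilter_on_def by meson
    then show ?thesis using insert.IH by blast
  qed blast
qed

text \<open>The blocks of a finite partition have union \<open>elts mk X Y\<close>, which lies in
  \<open>\<U>\<close>, so some block lies in \<open>\<U>\<close> and is a model.\<close>

lemma witnesses_imp_partition_regular:
  assumes "ultrafilter_on (elts mk X Y) \<U>" and "witnesses mk X \<U> x \<Phi>"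
  shows "partition_regular mk X Y x \<Phi>"
  unfolding partition_regular_def
proof (intro allI impI)
  fix \<A>
  assume "finite \<A> \<and> partition_on (elts mk X Y) \<A>"
  moreover from this have "\<Union>\<A> \<in> \<U>"
    using assms(1) by (auto simp: partition_on_def ultrafilter_on_def)
  ultimately show "\<exists>A\<in>\<A>. models mk X A x \<Phi>"
    using ultrafilter_on_mem_finite_Union[OF assms(1)] assms(2) unfolding witnesses_def by blast
qed

lemma witnesses_imp_solutions_mem:
  assumes "ultrafilter_on S \<U>" and "witnesses mk X \<U> x \<Phi>" and "A \<in> \<U>"
  shows "{a \<in> A. holds_at mk X x \<Phi> a} \<in> \<U>" (is "?I \<in> \<U>")
proof (rule ccontr)
  assume "?I \<notin> \<U>"
  moreover have "?I \<subseteq> S"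
    using assms(1,3) unfolding ultrafilter_on_def by auto
  ultimately have "A \<inter> (S - ?I) \<in> \<U>"
    using assms(1,3) unfolding ultrafilter_on_def by blast
  then have "models mk X (A \<inter> (S - ?I)) x \<Phi>"
    using assms(2) unfolding witnesses_def by (rule bspec[rotated])
  then show False
    unfolding models_def by simp
qed

theorem theorem5p11:
  fixes mk :: "'v set \<Rightarrow> 'v" and X :: "'v set" and Y :: 'v
    and x :: nat and \<phi> :: "'v form" and qs :: "'v bquant list" and \<U> :: "'v set set"
  assumes "superstructure mk X"
    and "Y \<in> V mk X"
    and "formula_over mk X \<phi>" and "totally_open \<phi>"
    and "distinct (x # map bvar qs)" and "free_vars \<phi> \<subseteq> set (x # map bvar qs)"
    and "\<forall>q\<in>set qs. bdom q \<in> V mk X"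
    and "partition_regular mk X Y x (close qs \<phi>)"
    and "ultrafilter_on (elts mk X Y) \<U>"
    and "witnesses mk X \<U> x (close qs \<phi>)"
  shows "(\<forall>A\<in>\<U>. {a \<in> A. holds_at mk X x (close qs \<phi>) a} \<in> \<U>) \<and>
         (\<forall>(\<psi> :: 'v form) (rs :: 'v bquant list).
           formula_over mk X \<psi> \<and> totally_open \<psi> \<and>
           distinct (x # map bvar (qs @ rs)) \<and> free_vars \<psi> \<subseteq> set (x # map bvar rs) \<and>
           (\<forall>r\<in>set rs. bdom r \<in> V mk X) \<and>
           witnesses mk X \<U> x (close rs \<psi>) \<longrightarrow>
           witnesses mk X \<U> x (close (qs @ rs) (Conj \<phi> \<psi>)) \<and>
           partition_regular mk X Y x (close (qs @ rs) (Conj \<phi> \<psi>)))"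
proof (intro conjI ballI allI impI; (elim conjE)?)
  fix A
  assume "A \<in> \<U>"
  then show "{a \<in> A. holds_at mk X x (close qs \<phi>) a} \<in> \<U>"
    by (rule witnesses_imp_solutions_mem[OF assms(9,10)])
next
  fix \<psi> :: "'v form" and rs :: "'v bquant list"
  assume dist: "distinct (x # map bvar (qs @ rs))"
    and fv: "free_vars \<psi> \<subseteq> set (x # map bvar rs)"
    and wit: "witnesses mk X \<U> x (close rs \<psi>)"
  have combine: "holds_at mk X x (close (qs @ rs) (Conj \<phi> \<psi>)) a"
    if "holds_at mk X x (close qs \<phi>) a" "holds_at mk X x (close rs \<psi>) a" for a
    using that unfolding holds_at_def
  proof (rule sat_close_append_Conj)
    \<comment> \<open>Once \<open>\<psi>\<close> is closed, at most \<open>x\<close> remains free,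
      and \<open>x\<close> differs from every variable of \<open>qs\<close>.\<close>
    show "bvar ` set qs \<inter> free_vars (close rs \<psi>) = {}"
      using dist fv by (auto simp: free_vars_close)
    show "bvar ` set rs \<inter> free_vars \<phi> = {}"
      using dist subsetD[OF assms(6)] by fastforce
  qed
  show "witnesses mk X \<U> x (close (qs @ rs) (Conj \<phi> \<psi>))"
    unfolding witnesses_def
  proof
    fix A
    assume "A \<in> \<U>"
    then have "{a \<in> A. holds_at mk X x (close qs \<phi>) a} \<in> \<U>"
      by (rule witnesses_imp_solutions_mem[OF assms(9,10)])
    \<comment> \<open>The second property is tested on the solutions of the first rather than on
      \<open>A\<close>, so one point satisfies both.\<close>
    then have "models mk X {a \<in> A. holds_at mk X x (close qs \<phi>) a} x (close rs \<psi>)"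
      using wit unfolding witnesses_def by (rule bspec[rotated])
    then show "models mk X A x (close (qs @ rs) (Conj \<phi> \<psi>))"
      using combine unfolding models_def by auto
  qed
  then show "partition_regular mk X Y x (close (qs @ rs) (Conj \<phi> \<psi>))"
    by (rule witnesses_imp_partition_regular[OF assms(9)])
qed

end
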